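(* Let $q$ be a prime power and let $v,k,d,m$ be positive integers with $k\le v$ and $d\le k$. Let $M$ be the $0/1$ incidence matrix whose rows are labeled by the $(k-d+1)$-dimensional subspaces $W$ of $GF(q)^v$ and whose columns are labeled by the $k$-dimensional subspaces $V$ of $GF(q)^v$, with $M_{W,V}=1$ if $W\subseteq V$ and $M_{W,V}=0$ otherwise. Let $s$ be the number of columns of $M$. Then there is a constant dimension code of dimension $k$ in $GF(q)^v$ with $m$ codewords and minimum subspace distance at least $2d$ if and only if there is a vector $x=(x_1,\ldots,x_s)^T\in\{0,1\}^s$ such that (1) $x_1+\cdots+x_s=m$, and (2) $Mx\le(1,\ldots,1)^T$ (componentwise, over the integers).
   Context: The subspace distance between subspaces $V,W$ of $GF(q)^v$ is $d_S(V,W)=\dim(V+W)-\dim(V\cap W)=\dim V+\dim W-2\dim(V\cap W)$. A constant dimension code of dimension $k$ in $GF(q)^v$ is a set $C$ of $k$-dimensional subspaces of $GF(q)^v$; its elements are its codewords. $C$ has minimum (subspace) distance at least $\delta$ if $d_S(V,W)\ge\delta$ for all distinct $V,W\in C$. *)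

theory Defs
  imports "HOL-Analysis.Analysis" "Jordan_Normal_Form.Matrix"
begin

text \<open>The ambient space \<open>GF(q)\<^sup>v\<close> is the type \<open>'a ^ 'n\<close> over a finite field \<open>'a\<close>
  with \<open>q\<close> elements, where \<open>'n\<close> has \<open>v\<close> elements; a finite field type automatically has
  prime power cardinality. Subspaces and dimension are those over the field \<open>'a\<close>,
  i.e. \<open>vec.subspace\<close> and \<open>vec.dim\<close>.\<close>

definition subspaces_of_dim :: "nat \<Rightarrow> ('a::field ^ 'n) set set" where
  "subspaces_of_dim r = {W. vec.subspace W \<and> vec.dim W = r}"

text \<open>Here \<open>V + W\<close> is the sum of subspaces, i.e. the elementwise sum of sets.\<close>

definition subspace_dist :: "('a::field ^ 'n) set \<Rightarrow> ('a ^ 'n) set \<Rightarrow> int" where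
  "subspace_dist V W = int (vec.dim (V + W)) - int (vec.dim (V \<inter> W))"

lemma subspace_dist_alt:
  fixes V W :: "('a::field ^ 'n) set"
  assumes "vec.subspace V" "vec.subspace W"
  shows "subspace_dist V W = int (vec.dim V) + int (vec.dim W) - 2 * int (vec.dim (V \<inter> W))"
proof -
  have "V + W = {x + y |x y. x \<in> V \<and> y \<in> W}"
    by (auto simp: set_plus_def)
  then show ?thesis
    using vec.dim_sums_Int[OF assms] by (simp add: subspace_dist_def)
qed

definition constant_dim_code :: "nat \<Rightarrow> ('a::field ^ 'n) set set \<Rightarrow> bool" where
  "constant_dim_code k C \<longleftrightarrow> C \<subseteq> subspaces_of_dim k"

definition min_subspace_dist_ge :: "nat \<Rightarrow> ('a::field ^ 'n) set set \<Rightarrow> bool" where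
  "min_subspace_dist_ge \<delta> C \<longleftrightarrow>
     (\<forall>V\<in>C. \<forall>W\<in>C. V \<noteq> W \<longrightarrow> int \<delta> \<le> subspace_dist V W)"

text \<open>A labelling of rows or columns by a finite set \<open>S\<close>: a list containing each element
  of \<open>S\<close> exactly once.\<close>

definition enumerates :: "'b list \<Rightarrow> 'b set \<Rightarrow> bool" where
  "enumerates xs S \<longleftrightarrow> distinct xs \<and> set xs = S"

definition incidence_mat :: "'b set list \<Rightarrow> 'b set list \<Rightarrow> int mat" where
  "incidence_mat Ws Vs =
     mat (length Ws) (length Vs) (\<lambda>(i, j). if Ws ! i \<subseteq> Vs ! j then 1 else 0)"

end

theory Submission
  imports Defs
begin

text \<open>For \<open>k\<close>-dimensional \<open>V\<close> and \<open>V'\<close> the distance is \<open>2 (k - dim (V \<inter> V'))\<close>, so it is less than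
  \<open>2 d\<close> exactly when \<open>V \<inter> V'\<close> contains some \<open>(k - d + 1)\<close>-dimensional \<open>W\<close>. A code is
  therefore good iff every such \<open>W\<close> lies in at most one codeword, and entry \<open>W\<close> of \<open>M x\<close> counts
  these codewords when \<open>x\<close> is the characteristic vector of the code.\<close>

text \<open>Any \<open>r\<close> vectors of a basis of \<open>U\<close> span a suitable
  \<open>W\<close>; the converse is monotonicity of dimension.\<close>

lemma le_dim_iff_ex_subspace:
  fixes U :: "('a::field ^ 'n) set"
  assumes "vec.subspace U"
  shows "r \<le> vec.dim U \<longleftrightarrow> (\<exists>W\<in>subspaces_of_dim r. W \<subseteq> U)"
proof
  assume r: "r \<le> vec.dim U"
  obtain B where B: "B \<subseteq> U" "vec.independent B" "U \<subseteq> vec.span B" "card B = vec.dim U"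
    by (rule vec.basis_exists)
  obtain B' where B': "B' \<subseteq> B" "card B' = r"
    using obtain_subset_with_card_n r B(4) by metis
  have "vec.span B' \<subseteq> U"
    using B' B(1) assms by (metis vec.span_minimal subset_trans)
  moreover have "vec.span B' \<in> subspaces_of_dim r"
    using B' vec.dim_span_eq_card_independent[OF vec.independent_mono[OF B(2) B'(1)]]
    by (simp add: subspaces_of_dim_def)
  ultimately show "\<exists>W\<in>subspaces_of_dim r. W \<subseteq> U" by blast
next
  show "\<exists>W\<in>subspaces_of_dim r. W \<subseteq> U \<Longrightarrow> r \<le> vec.dim U"
    by (auto simp: subspaces_of_dim_def intro: vec.dim_subset)
qed

lemma two_mult_le_subspace_dist_iff:
  fixes V V' :: "('a::field ^ 'n) set"
  assumes "V \<in> subspaces_of_dim k" "V' \<in> subspaces_of_dim k" "d \<le> k"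
  shows "int (2 * d) \<le> subspace_dist V V' \<longleftrightarrow>
           \<not> (\<exists>W\<in>subspaces_of_dim (k - d + 1). W \<subseteq> V \<and> W \<subseteq> V')"
proof -
  have s: "vec.subspace V" "vec.subspace V'" "vec.dim V = k" "vec.dim V' = k"
    using assms(1,2) by (auto simp: subspaces_of_dim_def)
  \<comment> \<open>The bound reads \<open>d + dim (V \<inter> V') \<le> k\<close>. Since
    \<open>d \<le> k\<close>, the subtraction \<open>k - d\<close> on naturals is not truncated, and
    negating \<open>dim (V \<inter> V') \<le> k - d\<close> produces the \<open>+ 1\<close>.\<close>
  have "int (2 * d) \<le> subspace_dist V V' \<longleftrightarrow> \<not> k - d + 1 \<le> vec.dim (V \<inter> V')"
    using s assms(3) by (auto simp: subspace_dist_alt)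
  also have "\<dots> \<longleftrightarrow> \<not> (\<exists>W\<in>subspaces_of_dim (k - d + 1). W \<subseteq> V \<inter> V')"
    using le_dim_iff_ex_subspace s vec.subspace_inter by metis
  finally show ?thesis by simp
qed

text \<open>Exchanging quantifiers turns "no two distinct codewords share a \<open>W\<close>" into
  "no \<open>W\<close> has two distinct codewords above it".\<close>

lemma min_subspace_dist_ge_iff:
  fixes C :: "('a::{field, finite} ^ 'n) set set"
  assumes "constant_dim_code k C" "d \<le> k"
  shows "min_subspace_dist_ge (2 * d) C \<longleftrightarrow>
           (\<forall>W\<in>subspaces_of_dim (k - d + 1). card {V \<in> C. W \<subseteq> V} \<le> 1)"
proof -
  have C: "V \<in> subspaces_of_dim k" if "V \<in> C" for V
    using assms(1) that by (auto simp: constant_dim_code_def)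
  have "min_subspace_dist_ge (2 * d) C \<longleftrightarrow>
      (\<forall>V\<in>C. \<forall>V'\<in>C. V \<noteq> V' \<longrightarrow>
         \<not> (\<exists>W\<in>subspaces_of_dim (k - d + 1). W \<subseteq> V \<and> W \<subseteq> V'))"
    unfolding min_subspace_dist_ge_def
    using two_mult_le_subspace_dist_iff[OF C C assms(2)]
    by (intro ball_cong imp_cong refl)
  also have "\<dots> \<longleftrightarrow> (\<forall>W\<in>subspaces_of_dim (k - d + 1). card {V \<in> C. W \<subseteq> V} \<le> 1)"
    \<comment> \<open>Finiteness of the field matters here: an infinite set has \<open>card\<close>
      0 and would satisfy the bound vacuously.\<close>
    by (simp only: One_nat_def card_le_Suc0_iff_eq[OF finite]) blast
  finally show ?thesis .
qed

lemma card_nth_Collect_eq: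
  assumes "distinct xs" "C \<subseteq> set xs"
  shows "card {j. j < length xs \<and> xs ! j \<in> C} = card C"
proof -
  have "(!) xs ` {j. j < length xs \<and> xs ! j \<in> C} = C"
    using assms(2) by (auto simp: in_set_conv_nth image_iff subset_iff)
  moreover have "inj_on ((!) xs) {j. j < length xs \<and> xs ! j \<in> C}"
    using assms(1) by (auto simp: inj_on_def nth_eq_iff_index_eq)
  ultimately show ?thesis by (metis card_image)
qed

definition indicator_vec :: "'b list \<Rightarrow> 'b set \<Rightarrow> int Matrix.vec" where
  "indicator_vec xs C = Matrix.vec (length xs) (\<lambda>j. of_bool (xs ! j \<in> C))"

lemma sum_indicator_vec:
  assumes "distinct xs" "C \<subseteq> set xs"
  shows "(\<Sum>j<length xs. vec_index (indicator_vec xs C) j) = int (card C)"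
proof -
  have "(\<Sum>j<length xs. vec_index (indicator_vec xs C) j)
      = (\<Sum>j<length xs. of_bool (xs ! j \<in> C))"
    by (simp add: indicator_vec_def)
  also have "\<dots> = int (card {j. j < length xs \<and> xs ! j \<in> C})"
    by (simp add: of_bool_def sum.If_cases Int_def)
  finally show ?thesis using card_nth_Collect_eq[OF assms] by simp
qed

lemma incidence_mat_mult_indicator_vec:
  assumes "distinct Vs" "C \<subseteq> set Vs" "i < length Ws"
  shows "vec_index (incidence_mat Ws Vs *\<^sub>v indicator_vec Vs C) i = int (card {V \<in> C. Ws ! i \<subseteq> V})"
proof -
  have row: "i < dim_row (incidence_mat Ws Vs)"
    using assms(3) by (simp add: incidence_mat_def)
  \<comment> \<open>A product of 0/1 entries is a conjunction, so multiplying row \<open>i\<close>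
    entrywise with the indicator of \<open>C\<close> gives the indicator of the codewords above
    \<open>Ws ! i\<close>.\<close>
  have "vec_index (incidence_mat Ws Vs *\<^sub>v indicator_vec Vs C) i
      = (\<Sum>j<length Vs. vec_index (indicator_vec Vs {V \<in> C. Ws ! i \<subseteq> V}) j)"
    using assms(3)
    unfolding index_mult_mat_vec[OF row] scalar_prod_def lessThan_atLeast0
    by (intro sum.cong) (auto simp: incidence_mat_def indicator_vec_def)
  also have "\<dots> = int (card {V \<in> C. Ws ! i \<subseteq> V})"
    using assms by (intro sum_indicator_vec) auto
  finally show ?thesis .
qed

text \<open>A 0/1 vector is determined by its support. Distinctness lets the support be read as a
  set of labels: a repeated label could carry both 0 and 1.\<close>

lemma zero_one_vec_eq_indicator_vec:
  assumes "distinct xs" "x \<in> carrier_vec (length xs)" "set\<^sub>v x \<subseteq> {0, 1}"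
  shows "x = indicator_vec xs {xs ! j |j. j < length xs \<and> vec_index x j = 1}"
proof
  fix j assume "j < dim_vec (indicator_vec xs {xs ! j |j. j < length xs \<and> vec_index x j = 1})"
  then have j: "j < length xs" by (simp add: indicator_vec_def)
  then have "vec_index x j \<in> {0, 1}"
    using assms(2,3) vec_setI by (metis carrier_vecD subsetD)
  moreover have "xs ! j \<in> {xs ! j |j. j < length xs \<and> vec_index x j = 1} \<longleftrightarrow> vec_index x j = 1"
    using assms(1) j by (auto simp: nth_eq_iff_index_eq)
  ultimately show "vec_index x j
      = vec_index (indicator_vec xs {xs ! j |j. j < length xs \<and> vec_index x j = 1}) j"
    using j by (auto simp: indicator_vec_def)
qed (use assms(2) in \<open>simp add: indicator_vec_def\<close>)

theorem theorem1:
  fixes q v k d m s :: nat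
    and Ws Vs :: "('a::{field, finite} ^ 'n) set list"
    and M :: "int mat"
  assumes "CARD('a) = q" and "CARD('n) = v"
    and "0 < k" and "0 < d" and "0 < m"
    and "k \<le> v" and "d \<le> k"
    and "enumerates Ws (subspaces_of_dim (k - d + 1))"
    and "enumerates Vs (subspaces_of_dim k)"
    and "M = incidence_mat Ws Vs"
    and "s = dim_col M"
  shows "(\<exists>C :: ('a ^ 'n) set set.
            constant_dim_code k C \<and> card C = m \<and> min_subspace_dist_ge (2 * d) C)
     \<longleftrightarrow> (\<exists>x :: int Matrix.vec. x \<in> carrier_vec s \<and> set\<^sub>v x \<subseteq> {0, 1} \<and>
            (\<Sum>j<s. vec_index x j) = int m \<and>
            M *\<^sub>v x \<le> Matrix.vec (dim_row M) (\<lambda>i. 1))"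
    (is "?L \<longleftrightarrow> (\<exists>x. ?P x)")
proof -
  have Ws: "set Ws = subspaces_of_dim (k - d + 1)"
    and Vs: "distinct Vs" "set Vs = subspaces_of_dim k"
    using assms(8,9) by (auto simp: enumerates_def)
  have s: "s = length Vs" "dim_row M = length Ws"
    using assms(10,11) by (auto simp: incidence_mat_def)
  \<comment> \<open>This equivalence for a fixed \<open>C\<close> serves both directions of the
    theorem.\<close>
  have code: "constant_dim_code k C \<and> card C = m \<and> min_subspace_dist_ge (2 * d) C
      \<longleftrightarrow> ?P (indicator_vec Vs C)" if C: "C \<subseteq> set Vs" for C
  proof -
    have cd: "constant_dim_code k C"
      using C Vs by (simp add: constant_dim_code_def)
    have "M *\<^sub>v indicator_vec Vs C \<le> Matrix.vec (dim_row M) (\<lambda>i. 1)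
        \<longleftrightarrow> (\<forall>i<length Ws. card {V \<in> C. Ws ! i \<subseteq> V} \<le> 1)"
      \<comment> \<open>The default rule for entries of a matrix-vector product is removed so that
        the counting lemma can rewrite them.\<close>
      using incidence_mat_mult_indicator_vec[OF Vs(1) C] s
      by (simp add: less_eq_vec_def assms(10) del: index_mult_mat_vec)
    also have "\<dots> \<longleftrightarrow> (\<forall>W\<in>set Ws. card {V \<in> C. W \<subseteq> V} \<le> 1)"
      by (auto simp: all_set_conv_all_nth)
    also have "\<dots> \<longleftrightarrow> min_subspace_dist_ge (2 * d) C"
      using min_subspace_dist_ge_iff[OF cd assms(7)] Ws by simp
    finally have "M *\<^sub>v indicator_vec Vs C \<le> Matrix.vec (dim_row M) (\<lambda>i. 1)
        \<longleftrightarrow> min_subspace_dist_ge (2 * d) C" .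
    moreover have "indicator_vec Vs C \<in> carrier_vec s" "set\<^sub>v (indicator_vec Vs C) \<subseteq> {0, 1}"
      by (auto simp: indicator_vec_def s vec_set_def)
    ultimately show ?thesis
      using cd sum_indicator_vec[OF Vs(1) C] s by auto
  qed
  show ?thesis
  proof
    assume ?L
    \<comment> \<open>The witness is \<open>indicator_vec Vs C\<close>; a constant dimension code is
      a subset of \<open>set Vs\<close> by definition.\<close>
    then show "\<exists>x. ?P x"
      using code Vs(2) by (metis constant_dim_code_def)
  next
    assume "\<exists>x. ?P x"
    then obtain x where x: "?P x" by blast
    \<comment> \<open>The code consists of the column labels in the support of
      \<open>x\<close>.\<close>
    let ?C = "{Vs ! j |j. j < length Vs \<and> vec_index x j = 1}"
    have "x = indicator_vec Vs ?C"
      using zero_one_vec_eq_indicator_vec[OF Vs(1)] x s(1) by blast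
    then have P: "?P (indicator_vec Vs ?C)"
      using x by simp
    have "?C \<subseteq> set Vs" by auto
    from iffD2[OF code[OF this] P] show ?L by (rule exI)
  qed
qed

end
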